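(* Let $\mathbb{C}=(C,\otimes,I,\alpha,\lambda,\rho)$ be a monoidal category and let $\mathsf{S}=(S,\mu)$ be a semigroup object in $\mathbb{C}$. Then $\mathcal{M}_{\mathbb{C},\mathsf{S}}\colon \mathsf{Conv}_I(\mathsf{S})\to (\mathit{Mult}_{\mathbb{C}}(\mathsf{S}),\star)$, $f\mapsto (L_f,R_f)$, is a homomorphism of semigroups, and in particular its image $\mathit{InnMult}_{\mathbb{C}}(\mathsf{S})$ is a sub-semigroup of $(\mathit{Mult}_{\mathbb{C}}(\mathsf{S}),\star)$.
   Context: A semigroup object in $\mathbb{C}$ is a pair $\mathsf{S}=(S,\mu\colon S\otimes S\to S)$ with $\mu$ associative (no unit required). $\mathit{Mult}_{\mathbb{C}}(\mathsf{S})$ is the set of pairs $(L,R)$ of $C$-morphisms $S\to S$ with $L\circ\mu=\mu\circ(L\otimes id_S)$, $R\circ\mu=\mu\circ(id_S\otimes R)$ and $\mu\circ(id_S\otimes L)=\mu\circ(R\otimes id_S)$; it is a monoid under $(L',R')\star(L,R)=(L'\circ L,R\circ R')$ with identity $(id_S,id_S)$. $\mathsf{Conv}_I(\mathsf{S})$ is the ordinary semigroup $(C(I,S),\bullet_\mu)$ with $g\bullet_\mu f=\mu\circ(g\otimes f)\circ\lambda_I^{-1}$. For $f\in C(I,S)$, $L_f:=\mu\circ(f\otimes id_S)\circ\lambda_S^{-1}$ and $R_f:=\mu\circ(id_S\otimes f)\circ\rho_S^{-1}$; one has $(L_f,R_f)\in\mathit{Mult}_{\mathbb{C}}(\mathsf{S})$.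 *)

theory Defs
  imports "HOL-Library.FuncSet"
begin

record ('o, 'm) category =
  Obj  :: "'o set"
  Arr  :: "'m set"
  Dom  :: "'m \<Rightarrow> 'o"
  Cod  :: "'m \<Rightarrow> 'o"
  Ident :: "'o \<Rightarrow> 'm"  ("\<one>\<index>")
  Comp :: "'m \<Rightarrow> 'm \<Rightarrow> 'm"  (infixl "\<cdot>\<index>" 70)

text \<open>\<open>\<one>\<^bsub>C\<^esub> A\<close> is the identity arrow of \<open>A\<close>.  Composition is in the usual
  (right-to-left) order: \<open>g \<cdot>\<^bsub>C\<^esub> f\<close> is ``\<open>g\<close> after \<open>f\<close>''.
  As everywhere below, it is meaningful only on composable arrows of the category.\<close>

definition Hom :: "('o, 'm, 'r) category_scheme \<Rightarrow> 'o \<Rightarrow> 'o \<Rightarrow> 'm set" where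
  "Hom C A B = {f \<in> Arr C. Dom C f = A \<and> Cod C f = B}"

locale category =
  fixes C :: "('o, 'm, 'r) category_scheme" (structure)
  assumes dom_in_Obj: "f \<in> Arr C \<Longrightarrow> Dom C f \<in> Obj C"
    and cod_in_Obj: "f \<in> Arr C \<Longrightarrow> Cod C f \<in> Obj C"
    and id_in_Hom: "A \<in> Obj C \<Longrightarrow> \<one> A \<in> Hom C A A"
    and comp_in_Hom: "\<lbrakk>f \<in> Hom C A B; g \<in> Hom C B D\<rbrakk> \<Longrightarrow> g \<cdot> f \<in> Hom C A D"
    and comp_id_left: "f \<in> Hom C A B \<Longrightarrow> \<one> B \<cdot> f = f"
    and comp_id_right: "f \<in> Hom C A B \<Longrightarrow> f \<cdot> \<one> A = f"
    and comp_assoc: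
      "\<lbrakk>f \<in> Hom C A B; g \<in> Hom C B D; h \<in> Hom C D E\<rbrakk> \<Longrightarrow> (h \<cdot> g) \<cdot> f = h \<cdot> (g \<cdot> f)"

definition inverse_arrows :: "('o, 'm, 'r) category_scheme \<Rightarrow> 'm \<Rightarrow> 'm \<Rightarrow> bool" where
  "inverse_arrows C f g \<longleftrightarrow>
     f \<in> Arr C \<and> g \<in> Hom C (Cod C f) (Dom C f) \<and>
     g \<cdot>\<^bsub>C\<^esub> f = \<one>\<^bsub>C\<^esub> (Dom C f) \<and> f \<cdot>\<^bsub>C\<^esub> g = \<one>\<^bsub>C\<^esub> (Cod C f)"

definition iso_arrow :: "('o, 'm, 'r) category_scheme \<Rightarrow> 'm \<Rightarrow> bool" where
  "iso_arrow C f \<longleftrightarrow> (\<exists>g. inverse_arrows C f g)"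

definition inv_arrow :: "('o, 'm, 'r) category_scheme \<Rightarrow> 'm \<Rightarrow> 'm" where
  "inv_arrow C f = (THE g. inverse_arrows C f g)"

record ('o, 'm) monoidal_category = "('o, 'm) category" +
  TensorObj :: "'o \<Rightarrow> 'o \<Rightarrow> 'o"  (infixr "\<otimes>\<^sub>o\<index>" 75)
  TensorArr :: "'m \<Rightarrow> 'm \<Rightarrow> 'm"  (infixr "\<otimes>\<index>" 75)
  UnitObj   :: "'o"  ("\<I>\<index>")
  Assoc     :: "'o \<Rightarrow> 'o \<Rightarrow> 'o \<Rightarrow> 'm"  ("\<alpha>\<index>")
  LUnitor   :: "'o \<Rightarrow> 'm"  ("\<lambda>\<^sub>u\<index>")
  RUnitor   :: "'o \<Rightarrow> 'm"  ("\<rho>\<^sub>u\<index>")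

text \<open>The equation \<open>\<lambda>\<^sub>u \<I> = \<rho>\<^sub>u \<I>\<close> is not an axiom: it follows from the pentagon and triangle
  identities (Kelly).\<close>

locale monoidal_category = category C
  for C :: "('o, 'm, 'r) monoidal_category_scheme" (structure) +
  assumes unit_in_Obj: "\<I> \<in> Obj C"
    and tensor_in_Obj: "\<lbrakk>A \<in> Obj C; B \<in> Obj C\<rbrakk> \<Longrightarrow> A \<otimes>\<^sub>o B \<in> Obj C"
    and tensor_in_Hom:
      "\<lbrakk>f \<in> Hom C A A'; g \<in> Hom C B B'\<rbrakk> \<Longrightarrow> f \<otimes> g \<in> Hom C (A \<otimes>\<^sub>o B) (A' \<otimes>\<^sub>o B')"
    and tensor_id: "\<lbrakk>A \<in> Obj C; B \<in> Obj C\<rbrakk> \<Longrightarrow> \<one> A \<otimes> \<one> B = \<one> (A \<otimes>\<^sub>o B)"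
    and tensor_comp:
      "\<lbrakk>f \<in> Hom C A A'; f' \<in> Hom C A' A''; g \<in> Hom C B B'; g' \<in> Hom C B' B''\<rbrakk>
        \<Longrightarrow> (f' \<cdot> f) \<otimes> (g' \<cdot> g) = (f' \<otimes> g') \<cdot> (f \<otimes> g)"
    and assoc_in_Hom:
      "\<lbrakk>A \<in> Obj C; B \<in> Obj C; D \<in> Obj C\<rbrakk>
        \<Longrightarrow> \<alpha> A B D \<in> Hom C ((A \<otimes>\<^sub>o B) \<otimes>\<^sub>o D) (A \<otimes>\<^sub>o (B \<otimes>\<^sub>o D))"
    and assoc_iso: "\<lbrakk>A \<in> Obj C; B \<in> Obj C; D \<in> Obj C\<rbrakk> \<Longrightarrow> iso_arrow C (\<alpha> A B D)"
    and assoc_natural: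
      "\<lbrakk>f \<in> Hom C A A'; g \<in> Hom C B B'; h \<in> Hom C D D'\<rbrakk>
        \<Longrightarrow> \<alpha> A' B' D' \<cdot> ((f \<otimes> g) \<otimes> h) = (f \<otimes> (g \<otimes> h)) \<cdot> \<alpha> A B D"
    and lunitor_in_Hom: "A \<in> Obj C \<Longrightarrow> \<lambda>\<^sub>u A \<in> Hom C (\<I> \<otimes>\<^sub>o A) A"
    and lunitor_iso: "A \<in> Obj C \<Longrightarrow> iso_arrow C (\<lambda>\<^sub>u A)"
    and lunitor_natural: "f \<in> Hom C A B \<Longrightarrow> \<lambda>\<^sub>u B \<cdot> (\<one> \<I> \<otimes> f) = f \<cdot> \<lambda>\<^sub>u A"
    and runitor_in_Hom: "A \<in> Obj C \<Longrightarrow> \<rho>\<^sub>u A \<in> Hom C (A \<otimes>\<^sub>o \<I>) A"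
    and runitor_iso: "A \<in> Obj C \<Longrightarrow> iso_arrow C (\<rho>\<^sub>u A)"
    and runitor_natural: "f \<in> Hom C A B \<Longrightarrow> \<rho>\<^sub>u B \<cdot> (f \<otimes> \<one> \<I>) = f \<cdot> \<rho>\<^sub>u A"
    and pentagon:
      "\<lbrakk>A \<in> Obj C; B \<in> Obj C; D \<in> Obj C; E \<in> Obj C\<rbrakk>
        \<Longrightarrow> (\<one> A \<otimes> \<alpha> B D E) \<cdot> \<alpha> A (B \<otimes>\<^sub>o D) E \<cdot> (\<alpha> A B D \<otimes> \<one> E)
          = \<alpha> A B (D \<otimes>\<^sub>o E) \<cdot> \<alpha> (A \<otimes>\<^sub>o B) D E"
    and triangle:
      "\<lbrakk>A \<in> Obj C; B \<in> Obj C\<rbrakk> \<Longrightarrow> (\<one> A \<otimes> \<lambda>\<^sub>u B) \<cdot> \<alpha> A \<I> B = \<rho>\<^sub>u A \<otimes> \<one> B"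

locale semigroup_object = monoidal_category C
  for C :: "('o, 'm, 'r) monoidal_category_scheme" (structure) +
  fixes S :: 'o and \<mu> :: 'm
  assumes carrier_in_Obj: "S \<in> Obj C"
    and mu_in_Hom: "\<mu> \<in> Hom C (S \<otimes>\<^sub>o S) S"
    and mu_assoc: "\<mu> \<cdot> (\<mu> \<otimes> \<one> S) = \<mu> \<cdot> (\<one> S \<otimes> \<mu>) \<cdot> \<alpha> S S S"

definition Mult :: "('o, 'm, 'r) monoidal_category_scheme \<Rightarrow> 'o \<Rightarrow> 'm \<Rightarrow> ('m \<times> 'm) set" where
  "Mult C S \<mu> = {(L, R). L \<in> Hom C S S \<and> R \<in> Hom C S S \<and>
     L \<cdot>\<^bsub>C\<^esub> \<mu> = \<mu> \<cdot>\<^bsub>C\<^esub> (L \<otimes>\<^bsub>C\<^esub> \<one>\<^bsub>C\<^esub> S) \<and>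
     R \<cdot>\<^bsub>C\<^esub> \<mu> = \<mu> \<cdot>\<^bsub>C\<^esub> (\<one>\<^bsub>C\<^esub> S \<otimes>\<^bsub>C\<^esub> R) \<and>
     \<mu> \<cdot>\<^bsub>C\<^esub> (\<one>\<^bsub>C\<^esub> S \<otimes>\<^bsub>C\<^esub> L) = \<mu> \<cdot>\<^bsub>C\<^esub> (R \<otimes>\<^bsub>C\<^esub> \<one>\<^bsub>C\<^esub> S)}"

definition mult_star ::
    "('o, 'm, 'r) monoidal_category_scheme \<Rightarrow> 'm \<times> 'm \<Rightarrow> 'm \<times> 'm \<Rightarrow> 'm \<times> 'm" where
  "mult_star C = (\<lambda>(L', R') (L, R). (L' \<cdot>\<^bsub>C\<^esub> L, R \<cdot>\<^bsub>C\<^esub> R'))"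

definition conv :: "('o, 'm, 'r) monoidal_category_scheme \<Rightarrow> 'm \<Rightarrow> 'm \<Rightarrow> 'm \<Rightarrow> 'm" where
  "conv C \<mu> g f = \<mu> \<cdot>\<^bsub>C\<^esub> (g \<otimes>\<^bsub>C\<^esub> f) \<cdot>\<^bsub>C\<^esub> inv_arrow C (\<lambda>\<^sub>u\<^bsub>C\<^esub> \<I>\<^bsub>C\<^esub>)"

definition left_mult :: "('o, 'm, 'r) monoidal_category_scheme \<Rightarrow> 'o \<Rightarrow> 'm \<Rightarrow> 'm \<Rightarrow> 'm" where
  "left_mult C S \<mu> f = \<mu> \<cdot>\<^bsub>C\<^esub> (f \<otimes>\<^bsub>C\<^esub> \<one>\<^bsub>C\<^esub> S) \<cdot>\<^bsub>C\<^esub> inv_arrow C (\<lambda>\<^sub>u\<^bsub>C\<^esub> S)"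

definition right_mult :: "('o, 'm, 'r) monoidal_category_scheme \<Rightarrow> 'o \<Rightarrow> 'm \<Rightarrow> 'm \<Rightarrow> 'm" where
  "right_mult C S \<mu> f = \<mu> \<cdot>\<^bsub>C\<^esub> (\<one>\<^bsub>C\<^esub> S \<otimes>\<^bsub>C\<^esub> f) \<cdot>\<^bsub>C\<^esub> inv_arrow C (\<rho>\<^sub>u\<^bsub>C\<^esub> S)"

definition mult_map ::
    "('o, 'm, 'r) monoidal_category_scheme \<Rightarrow> 'o \<Rightarrow> 'm \<Rightarrow> 'm \<Rightarrow> 'm \<times> 'm" where
  "mult_map C S \<mu> f = (left_mult C S \<mu> f, right_mult C S \<mu> f)"

definition InnMult :: "('o, 'm, 'r) monoidal_category_scheme \<Rightarrow> 'o \<Rightarrow> 'm \<Rightarrow> ('m \<times> 'm) set" where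
  "InnMult C S \<mu> = mult_map C S \<mu> ` Hom C \<I>\<^bsub>C\<^esub> S"

text \<open>The carrier may be empty: there need not be any arrow from the unit object to \<open>S\<close>.\<close>

locale semigroup_on =
  fixes M :: "'a set" and mul :: "'a \<Rightarrow> 'a \<Rightarrow> 'a"
  assumes mul_closed: "\<lbrakk>x \<in> M; y \<in> M\<rbrakk> \<Longrightarrow> mul x y \<in> M"
    and mul_assoc: "\<lbrakk>x \<in> M; y \<in> M; z \<in> M\<rbrakk> \<Longrightarrow> mul (mul x y) z = mul x (mul y z)"

locale semigroup_homomorphism =
  source: semigroup_on M mul + target: semigroup_on N mul'
  for M :: "'a set" and mul :: "'a \<Rightarrow> 'a \<Rightarrow> 'a"
    and N :: "'b set" and mul' :: "'b \<Rightarrow> 'b \<Rightarrow> 'b" +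
  fixes h :: "'a \<Rightarrow> 'b"
  assumes hom_closed: "h \<in> M \<rightarrow> N"
    and hom_mul: "\<lbrakk>x \<in> M; y \<in> M\<rbrakk> \<Longrightarrow> h (mul x y) = mul' (h x) (h y)"

locale subsemigroup = semigroup_on M mul
  for H :: "'a set" and M :: "'a set" and mul :: "'a \<Rightarrow> 'a \<Rightarrow> 'a" +
  assumes sub_carrier: "H \<subseteq> M"
    and sub_closed: "\<lbrakk>x \<in> H; y \<in> H\<rbrakk> \<Longrightarrow> mul x y \<in> H"

end

theory Submission
  imports Defs
begin

text \<open>
  Precomposing with the unitors turns the definitions of the multiplications by \<open>f\<close> into
  \<open>L\<^sub>f \<cdot> \<lambda> S = \<mu> \<cdot> (f \<otimes> \<one> S)\<close> and \<open>R\<^sub>f \<cdot> \<rho> S = \<mu> \<cdot> (\<one> S \<otimes> f)\<close>.  As unitors and their tensor products with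
  identities can be cancelled, the multiplier equations reduce to associativity of \<open>\<mu>\<close>, using Kelly's
  identities for \<open>\<lambda> (A \<otimes> B)\<close> and \<open>\<rho> (A \<otimes> B)\<close> and the triangle.  Moreover the convolution of \<open>g\<close> and \<open>f\<close>
  is \<open>L\<^sub>g \<cdot> f\<close>, and also \<open>R\<^sub>f \<cdot> g\<close> because \<open>\<lambda> \<I> = \<rho> \<I>\<close>; multiplicativity and associativity of
  convolution follow from this together with the multiplier equations.
\<close>

text \<open>With domains and codomains as functions, the typing side conditions below have no extra
  variables, so the simplifier can discharge them.\<close>

lemma mem_Hom_iff: "f \<in> Hom C A B \<longleftrightarrow> f \<in> Arr C \<and> Dom C f = A \<and> Cod C f = B"
  by (auto simp: Hom_def)

section \<open>Calculus of arrows, inverses and cancellation in a category\<close>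

context category
begin

lemma id_typing [simp]:
  assumes "A \<in> Obj C"
  shows "\<one> A \<in> Arr C" "Dom C (\<one> A) = A" "Cod C (\<one> A) = A"
  using id_in_Hom[OF assms] by (auto simp: mem_Hom_iff)

lemma comp_typing [simp]:
  assumes "f \<in> Arr C" "g \<in> Arr C" "Dom C g = Cod C f"
  shows "g \<cdot> f \<in> Arr C" "Dom C (g \<cdot> f) = Dom C f" "Cod C (g \<cdot> f) = Cod C g"
  using comp_in_Hom[of f "Dom C f" "Cod C f" g "Cod C g"] assms by (auto simp: mem_Hom_iff)

lemma comp_id [simp]:
  "\<lbrakk>f \<in> Arr C; Cod C f = B\<rbrakk> \<Longrightarrow> \<one> B \<cdot> f = f"
  "\<lbrakk>f \<in> Arr C; Dom C f = A\<rbrakk> \<Longrightarrow> f \<cdot> \<one> A = f"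
  by (auto intro: comp_id_left comp_id_right simp: mem_Hom_iff)

lemma comp_assoc_arr:
  "\<lbrakk>f \<in> Arr C; g \<in> Arr C; h \<in> Arr C; Dom C g = Cod C f; Dom C h = Cod C g\<rbrakk>
    \<Longrightarrow> (h \<cdot> g) \<cdot> f = h \<cdot> (g \<cdot> f)"
  by (rule comp_assoc) (auto simp: mem_Hom_iff)

text \<open>Evaluating \<open>d \<cdot> e \<cdot> d'\<close> in both ways gives \<open>d\<close> and
  \<open>d'\<close>. This uniqueness makes the definite description in \<open>inv_arrow\<close>
  denote an inverse.\<close>

lemma inverse_arrows_unique:
  assumes "inverse_arrows C e d" "inverse_arrows C e d'"
  shows "d = d'"
proof -
  have "(d \<cdot> e) \<cdot> d' = d \<cdot> (e \<cdot> d')"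
    using assms by (intro comp_assoc_arr) (auto simp: inverse_arrows_def mem_Hom_iff)
  then show ?thesis
    using assms by (simp add: inverse_arrows_def mem_Hom_iff)
qed

lemma inverse_arrows_inv_arrow: "iso_arrow C e \<Longrightarrow> inverse_arrows C e (inv_arrow C e)"
  unfolding iso_arrow_def inv_arrow_def by (metis theI inverse_arrows_unique)

lemma inv_arrow_typing [simp]:
  assumes "iso_arrow C e"
  shows "inv_arrow C e \<in> Arr C" "Dom C (inv_arrow C e) = Cod C e" "Cod C (inv_arrow C e) = Dom C e"
  using inverse_arrows_inv_arrow[OF assms] by (auto simp: inverse_arrows_def mem_Hom_iff)

lemma inv_arrow_comp [simp]:
  assumes "iso_arrow C e"
  shows "inv_arrow C e \<cdot> e = \<one> (Dom C e)" "e \<cdot> inv_arrow C e = \<one> (Cod C e)"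
  using inverse_arrows_inv_arrow[OF assms] by (auto simp: inverse_arrows_def)

lemma iso_arrow_Arr: "iso_arrow C e \<Longrightarrow> e \<in> Arr C"
  by (auto simp: iso_arrow_def inverse_arrows_def)

lemma iso_cancel_right:
  assumes "iso_arrow C e" "f \<in> Arr C" "g \<in> Arr C" "Dom C f = Cod C e" "Dom C g = Cod C e"
    and "f \<cdot> e = g \<cdot> e"
  shows "f = g"
proof -
  have "(f \<cdot> e) \<cdot> inv_arrow C e = (g \<cdot> e) \<cdot> inv_arrow C e"
    using assms by simp
  then show ?thesis
    using assms(1-5) by (simp add: comp_assoc_arr iso_arrow_Arr)
qed

lemma iso_cancel_left:
  assumes "iso_arrow C e" "f \<in> Arr C" "g \<in> Arr C" "Cod C f = Dom C e" "Cod C g = Dom C e"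
    and "e \<cdot> f = e \<cdot> g"
  shows "f = g"
proof -
  have "inv_arrow C e \<cdot> (e \<cdot> f) = inv_arrow C e \<cdot> (e \<cdot> g)"
    using assms by simp
  then show ?thesis
    using assms(1-5) by (simp add: comp_assoc_arr[symmetric] iso_arrow_Arr)
qed

end

section \<open>Interchange, naturality and Kelly's coherence identities\<close>

context monoidal_category
begin

declare unit_in_Obj [simp] tensor_in_Obj [simp] tensor_id [simp]
  assoc_iso [simp] lunitor_iso [simp] runitor_iso [simp]

lemma tensor_typing [simp]:
  assumes "f \<in> Arr C" "g \<in> Arr C"
  shows "f \<otimes> g \<in> Arr C" "Dom C (f \<otimes> g) = Dom C f \<otimes>\<^sub>o Dom C g" "Cod C (f \<otimes> g) = Cod C f \<otimes>\<^sub>o Cod C g"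
  using tensor_in_Hom[of f "Dom C f" "Cod C f" g "Dom C g" "Cod C g"] assms
  by (auto simp: mem_Hom_iff)

lemma assoc_typing [simp]:
  assumes "A \<in> Obj C" "B \<in> Obj C" "D \<in> Obj C"
  shows "\<alpha> A B D \<in> Arr C" "Dom C (\<alpha> A B D) = (A \<otimes>\<^sub>o B) \<otimes>\<^sub>o D" "Cod C (\<alpha> A B D) = A \<otimes>\<^sub>o (B \<otimes>\<^sub>o D)"
  using assoc_in_Hom[OF assms] by (auto simp: mem_Hom_iff)

lemma lunitor_typing [simp]:
  assumes "A \<in> Obj C"
  shows "\<lambda>\<^sub>u A \<in> Arr C" "Dom C (\<lambda>\<^sub>u A) = \<I> \<otimes>\<^sub>o A" "Cod C (\<lambda>\<^sub>u A) = A"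
  using lunitor_in_Hom[OF assms] by (auto simp: mem_Hom_iff)

lemma runitor_typing [simp]:
  assumes "A \<in> Obj C"
  shows "\<rho>\<^sub>u A \<in> Arr C" "Dom C (\<rho>\<^sub>u A) = A \<otimes>\<^sub>o \<I>" "Cod C (\<rho>\<^sub>u A) = A"
  using runitor_in_Hom[OF assms] by (auto simp: mem_Hom_iff)

lemma interchange:
  "\<lbrakk>f \<in> Arr C; f' \<in> Arr C; g \<in> Arr C; g' \<in> Arr C; Dom C f' = Cod C f; Dom C g' = Cod C g\<rbrakk>
    \<Longrightarrow> (f' \<otimes> g') \<cdot> (f \<otimes> g) = (f' \<cdot> f) \<otimes> (g' \<cdot> g)"
  by (rule tensor_comp[symmetric]) (auto simp: mem_Hom_iff)

text \<open>Complements \<open>interchange\<close> for composites nested to the right by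
  \<open>comp_assoc_arr\<close>, where the inner tensor product is followed by a further factor
  \<open>h\<close>.\<close>

lemma interchange_assoc:
  assumes "f \<in> Arr C" "f' \<in> Arr C" "g \<in> Arr C" "g' \<in> Arr C" "h \<in> Arr C"
    and "Dom C f' = Cod C f" "Dom C g' = Cod C g" "Cod C h = Dom C f \<otimes>\<^sub>o Dom C g"
  shows "(f' \<otimes> g') \<cdot> ((f \<otimes> g) \<cdot> h) = ((f' \<cdot> f) \<otimes> (g' \<cdot> g)) \<cdot> h"
  using assms by (simp add: comp_assoc_arr[symmetric] interchange)

lemma assoc_natural_arr:
  "\<lbrakk>f \<in> Arr C; g \<in> Arr C; h \<in> Arr C\<rbrakk>
    \<Longrightarrow> \<alpha> (Cod C f) (Cod C g) (Cod C h) \<cdot> ((f \<otimes> g) \<otimes> h)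
      = (f \<otimes> (g \<otimes> h)) \<cdot> \<alpha> (Dom C f) (Dom C g) (Dom C h)"
  by (rule assoc_natural) (auto simp: mem_Hom_iff)

lemma lunitor_natural_arr: "f \<in> Arr C \<Longrightarrow> \<lambda>\<^sub>u (Cod C f) \<cdot> (\<one> \<I> \<otimes> f) = f \<cdot> \<lambda>\<^sub>u (Dom C f)"
  by (rule lunitor_natural) (auto simp: mem_Hom_iff)

lemma runitor_natural_arr: "f \<in> Arr C \<Longrightarrow> \<rho>\<^sub>u (Cod C f) \<cdot> (f \<otimes> \<one> \<I>) = f \<cdot> \<rho>\<^sub>u (Dom C f)"
  by (rule runitor_natural) (auto simp: mem_Hom_iff)

lemma iso_arrow_tensor:
  assumes "iso_arrow C e" "iso_arrow C e'"
  shows "iso_arrow C (e \<otimes> e')"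
proof -
  have "inverse_arrows C (e \<otimes> e') (inv_arrow C e \<otimes> inv_arrow C e')"
    using assms
    by (simp add: inverse_arrows_def mem_Hom_iff interchange iso_arrow_Arr dom_in_Obj cod_in_Obj)
  then show ?thesis
    by (auto simp: iso_arrow_def)
qed

lemma iso_arrow_id: "A \<in> Obj C \<Longrightarrow> iso_arrow C (\<one> A)"
  by (auto simp: iso_arrow_def inverse_arrows_def mem_Hom_iff intro!: exI[of _ "\<one> A"])

lemma iso_arrow_comp:
  assumes "iso_arrow C e" "iso_arrow C e'" "Dom C e' = Cod C e"
  shows "iso_arrow C (e' \<cdot> e)"
proof -
  \<comment> \<open>Once both round trips are nested to the right, the inner mutually inverse pair
    stands in exactly these two shapes.\<close>
  have "inv_arrow C e' \<cdot> (e' \<cdot> e) = e" "e \<cdot> (inv_arrow C e \<cdot> inv_arrow C e') = inv_arrow C e'"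
    using assms by (simp_all add: comp_assoc_arr[symmetric] iso_arrow_Arr)
  then have "inverse_arrows C (e' \<cdot> e) (inv_arrow C e \<cdot> inv_arrow C e')"
    using assms by (simp add: inverse_arrows_def mem_Hom_iff comp_assoc_arr iso_arrow_Arr)
  then show ?thesis
    by (auto simp: iso_arrow_def)
qed

text \<open>By naturality of the left unitor, \<open>f \<cdot> \<lambda>\<^sub>u (Dom C f)\<close>
  is determined by \<open>\<one> \<I> \<otimes> f\<close>, and the unitor can be cancelled. This
  allows an equation to be tested after tensoring with the unit, where pentagon and triangle become
  available.\<close>

lemma unit_tensor_faithful:
  assumes "f \<in> Arr C" "g \<in> Arr C" "Dom C f = Dom C g" "Cod C f = Cod C g"
    and "\<one> \<I> \<otimes> f = \<one> \<I> \<otimes> g"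
  shows "f = g"
proof (rule iso_cancel_right)
  show "f \<cdot> \<lambda>\<^sub>u (Dom C f) = g \<cdot> \<lambda>\<^sub>u (Dom C f)"
    using assms lunitor_natural_arr[of f] lunitor_natural_arr[of g] by simp
qed (use assms in \<open>auto simp: dom_in_Obj\<close>)

lemma tensor_unit_faithful:
  assumes "f \<in> Arr C" "g \<in> Arr C" "Dom C f = Dom C g" "Cod C f = Cod C g"
    and "f \<otimes> \<one> \<I> = g \<otimes> \<one> \<I>"
  shows "f = g"
proof (rule iso_cancel_right)
  show "f \<cdot> \<rho>\<^sub>u (Dom C f) = g \<cdot> \<rho>\<^sub>u (Dom C f)"
    using assms runitor_natural_arr[of f] runitor_natural_arr[of g] by simp
qed (use assms in \<open>auto simp: dom_in_Obj\<close>)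

text \<open>After tensoring with \<open>\<I>\<close> on the left, the pentagon at
  \<open>\<I>\<close>, \<open>\<I>\<close>, \<open>A\<close>, \<open>B\<close> and two triangles
  relate both sides; the two associators in \<open>?e\<close> are then cancelled.\<close>

lemma lunitor_tensor:
  assumes [simp]: "A \<in> Obj C" "B \<in> Obj C"
  shows "\<lambda>\<^sub>u (A \<otimes>\<^sub>o B) \<cdot> \<alpha> \<I> A B = \<lambda>\<^sub>u A \<otimes> \<one> B"
proof (rule unit_tensor_faithful)
  \<comment> \<open>These are the two remaining factors on the three-arrow side of the pentagon,
    next to \<open>\<one> \<I> \<otimes> \<alpha> \<I> A B\<close>.\<close>
  let ?e = "\<alpha> \<I> (\<I> \<otimes>\<^sub>o A) B \<cdot> (\<alpha> \<I> \<I> A \<otimes> \<one> B)"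
  show "\<one> \<I> \<otimes> (\<lambda>\<^sub>u (A \<otimes>\<^sub>o B) \<cdot> \<alpha> \<I> A B) = \<one> \<I> \<otimes> (\<lambda>\<^sub>u A \<otimes> \<one> B)"
  proof (rule iso_cancel_right)
    show "iso_arrow C ?e"
      by (simp add: iso_arrow_comp iso_arrow_tensor iso_arrow_id)
    have "(\<one> \<I> \<otimes> (\<lambda>\<^sub>u (A \<otimes>\<^sub>o B) \<cdot> \<alpha> \<I> A B)) \<cdot> ?e
        = (\<one> \<I> \<otimes> \<lambda>\<^sub>u (A \<otimes>\<^sub>o B)) \<cdot> ((\<one> \<I> \<otimes> \<alpha> \<I> A B) \<cdot> \<alpha> \<I> (\<I> \<otimes>\<^sub>o A) B \<cdot> (\<alpha> \<I> \<I> A \<otimes> \<one> B))"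
      by (simp add: comp_assoc_arr interchange_assoc)
    also have "\<dots> = (\<one> \<I> \<otimes> \<lambda>\<^sub>u (A \<otimes>\<^sub>o B)) \<cdot> (\<alpha> \<I> \<I> (A \<otimes>\<^sub>o B) \<cdot> \<alpha> (\<I> \<otimes>\<^sub>o \<I>) A B)"
      by (simp add: pentagon)
    also have "\<dots> = ((\<one> \<I> \<otimes> \<lambda>\<^sub>u (A \<otimes>\<^sub>o B)) \<cdot> \<alpha> \<I> \<I> (A \<otimes>\<^sub>o B)) \<cdot> \<alpha> (\<I> \<otimes>\<^sub>o \<I>) A B"
      by (simp add: comp_assoc_arr)
    \<comment> \<open>The identity on \<open>A \<otimes>\<^sub>o B\<close> coming from the triangle
      is split into a tensor product, the form to which naturality of the associator
      applies.\<close>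
    also have "\<dots> = (\<rho>\<^sub>u \<I> \<otimes> (\<one> A \<otimes> \<one> B)) \<cdot> \<alpha> (\<I> \<otimes>\<^sub>o \<I>) A B"
      by (simp add: triangle)
    also have "\<dots> = \<alpha> \<I> A B \<cdot> ((\<rho>\<^sub>u \<I> \<otimes> \<one> A) \<otimes> \<one> B)"
      using assoc_natural_arr[of "\<rho>\<^sub>u \<I>" "\<one> A" "\<one> B"] by simp
    \<comment> \<open>Here the triangle at \<open>\<I>\<close> and \<open>A\<close> is read
      backwards, which brings in the last factor of \<open>?e\<close>.\<close>
    also have "\<dots> = \<alpha> \<I> A B \<cdot> (((\<one> \<I> \<otimes> \<lambda>\<^sub>u A) \<otimes> \<one> B) \<cdot> (\<alpha> \<I> \<I> A \<otimes> \<one> B))"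
      by (simp add: triangle interchange)
    also have "\<dots> = (\<one> \<I> \<otimes> (\<lambda>\<^sub>u A \<otimes> \<one> B)) \<cdot> ?e"
      using assoc_natural_arr[of "\<one> \<I>" "\<lambda>\<^sub>u A" "\<one> B"] by (simp add: comp_assoc_arr[symmetric])
    finally show "(\<one> \<I> \<otimes> (\<lambda>\<^sub>u (A \<otimes>\<^sub>o B) \<cdot> \<alpha> \<I> A B)) \<cdot> ?e = (\<one> \<I> \<otimes> (\<lambda>\<^sub>u A \<otimes> \<one> B)) \<cdot> ?e" .
  qed auto
qed auto

text \<open>Mirror argument: tensor with \<open>\<I>\<close> on the right and use the pentagon at
  \<open>A\<close>, \<open>B\<close>, \<open>\<I>\<close>, \<open>\<I>\<close>. The arrow cancelled
  is now \<open>\<alpha> A B \<I>\<close>, on the left.\<close>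

lemma runitor_tensor:
  assumes [simp]: "A \<in> Obj C" "B \<in> Obj C"
  shows "\<rho>\<^sub>u (A \<otimes>\<^sub>o B) = (\<one> A \<otimes> \<rho>\<^sub>u B) \<cdot> \<alpha> A B \<I>"
proof (rule tensor_unit_faithful)
  show "\<rho>\<^sub>u (A \<otimes>\<^sub>o B) \<otimes> \<one> \<I> = ((\<one> A \<otimes> \<rho>\<^sub>u B) \<cdot> \<alpha> A B \<I>) \<otimes> \<one> \<I>"
  proof (rule iso_cancel_left)
    show "iso_arrow C (\<alpha> A B \<I>)"
      by simp
    \<comment> \<open>The triangle at \<open>A \<otimes>\<^sub>o B\<close> and \<open>\<I>\<close>
      brings in \<open>\<lambda>\<^sub>u \<I>\<close>; the identity is kept split so that naturality
      of the associator can follow.\<close>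
    have "\<alpha> A B \<I> \<cdot> (\<rho>\<^sub>u (A \<otimes>\<^sub>o B) \<otimes> \<one> \<I>)
        = (\<alpha> A B \<I> \<cdot> ((\<one> A \<otimes> \<one> B) \<otimes> \<lambda>\<^sub>u \<I>)) \<cdot> \<alpha> (A \<otimes>\<^sub>o B) \<I> \<I>"
      using triangle[of "A \<otimes>\<^sub>o B" \<I>] by (simp add: comp_assoc_arr)
    also have "\<dots> = (\<one> A \<otimes> (\<one> B \<otimes> \<lambda>\<^sub>u \<I>)) \<cdot> (\<alpha> A B (\<I> \<otimes>\<^sub>o \<I>) \<cdot> \<alpha> (A \<otimes>\<^sub>o B) \<I> \<I>)"
      using assoc_natural_arr[of "\<one> A" "\<one> B" "\<lambda>\<^sub>u \<I>"] by (simp add: comp_assoc_arr del: tensor_id)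
    also have "\<dots> = (\<one> A \<otimes> (\<one> B \<otimes> \<lambda>\<^sub>u \<I>)) \<cdot>
        ((\<one> A \<otimes> \<alpha> B \<I> \<I>) \<cdot> \<alpha> A (B \<otimes>\<^sub>o \<I>) \<I> \<cdot> (\<alpha> A B \<I> \<otimes> \<one> \<I>))"
      by (simp add: pentagon)
    also have "\<dots> = ((\<one> A \<otimes> (\<rho>\<^sub>u B \<otimes> \<one> \<I>)) \<cdot> \<alpha> A (B \<otimes>\<^sub>o \<I>) \<I>) \<cdot> (\<alpha> A B \<I> \<otimes> \<one> \<I>)"
      by (simp add: comp_assoc_arr interchange_assoc triangle)
    also have "\<dots> = (\<alpha> A B \<I> \<cdot> ((\<one> A \<otimes> \<rho>\<^sub>u B) \<otimes> \<one> \<I>)) \<cdot> (\<alpha> A B \<I> \<otimes> \<one> \<I>)"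
      using assoc_natural_arr[of "\<one> A" "\<rho>\<^sub>u B" "\<one> \<I>"] by simp
    also have "\<dots> = \<alpha> A B \<I> \<cdot> (((\<one> A \<otimes> \<rho>\<^sub>u B) \<cdot> \<alpha> A B \<I>) \<otimes> \<one> \<I>)"
      by (simp add: comp_assoc_arr interchange)
    finally show "\<alpha> A B \<I> \<cdot> (\<rho>\<^sub>u (A \<otimes>\<^sub>o B) \<otimes> \<one> \<I>)
        = \<alpha> A B \<I> \<cdot> (((\<one> A \<otimes> \<rho>\<^sub>u B) \<cdot> \<alpha> A B \<I>) \<otimes> \<one> \<I>)" .
  qed auto
qed auto

text \<open>Naturality of the left unitor at its own component \<open>\<lambda>\<^sub>u \<I>\<close>
  rewrites \<open>\<lambda>\<^sub>u (\<I> \<otimes>\<^sub>o \<I>)\<close>. Then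
  \<open>lunitor_tensor\<close> and the triangle give the same composite, and tensoring with the
  unit is faithful.\<close>

lemma lunitor_unit_eq_runitor_unit: "\<lambda>\<^sub>u \<I> = \<rho>\<^sub>u \<I>"
proof (rule tensor_unit_faithful)
  have "\<lambda>\<^sub>u (\<I> \<otimes>\<^sub>o \<I>) = \<one> \<I> \<otimes> \<lambda>\<^sub>u \<I>"
    by (rule iso_cancel_left[of "\<lambda>\<^sub>u \<I>"]) (use lunitor_natural_arr[of "\<lambda>\<^sub>u \<I>"] in auto)
  then show "\<lambda>\<^sub>u \<I> \<otimes> \<one> \<I> = \<rho>\<^sub>u \<I> \<otimes> \<one> \<I>"
    using lunitor_tensor[of \<I> \<I>] triangle[of \<I> \<I>] by simp
qed auto

end

section \<open>Inner multiplications of a semigroup object as multipliers\<close>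

context semigroup_object
begin

declare carrier_in_Obj [simp]

abbreviation "L \<equiv> left_mult C S \<mu>"
abbreviation "R \<equiv> right_mult C S \<mu>"

lemma mu_typing [simp]: "\<mu> \<in> Arr C" "Dom C \<mu> = S \<otimes>\<^sub>o S" "Cod C \<mu> = S"
  using mu_in_Hom by (auto simp: mem_Hom_iff)

lemma mult_typing [simp]:
  assumes "f \<in> Hom C \<I> S"
  shows "L f \<in> Arr C" "Dom C (L f) = S" "Cod C (L f) = S"
    and "R f \<in> Arr C" "Dom C (R f) = S" "Cod C (R f) = S"
  using assms by (auto simp: left_mult_def right_mult_def mem_Hom_iff)

lemma left_mult_lunitor:
  assumes "f \<in> Hom C \<I> S"
  shows "L f \<cdot> \<lambda>\<^sub>u S = \<mu> \<cdot> (f \<otimes> \<one> S)"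
  using assms by (simp add: left_mult_def mem_Hom_iff comp_assoc_arr)

lemma right_mult_runitor:
  assumes "f \<in> Hom C \<I> S"
  shows "R f \<cdot> \<rho>\<^sub>u S = \<mu> \<cdot> (\<one> S \<otimes> f)"
  using assms by (simp add: right_mult_def mem_Hom_iff comp_assoc_arr)

text \<open>Serves to recognise a composite of left multiplications as the left multiplication by a
  convolution without handling inverse unitors.\<close>

lemma left_mult_eqI:
  assumes "f \<in> Hom C \<I> S" "l \<in> Hom C S S" "l \<cdot> \<lambda>\<^sub>u S = \<mu> \<cdot> (f \<otimes> \<one> S)"
  shows "L f = l"
  by (rule iso_cancel_right[of "\<lambda>\<^sub>u S"])
    (use assms left_mult_lunitor[of f] in \<open>auto simp: mem_Hom_iff[of l]\<close>)

lemma right_mult_eqI: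
  assumes "f \<in> Hom C \<I> S" "r \<in> Hom C S S" "r \<cdot> \<rho>\<^sub>u S = \<mu> \<cdot> (\<one> S \<otimes> f)"
  shows "R f = r"
  by (rule iso_cancel_right[of "\<rho>\<^sub>u S"])
    (use assms right_mult_runitor[of f] in \<open>auto simp: mem_Hom_iff[of r]\<close>)

text \<open>Associativity on generalised elements: factor out
  \<open>(f \<otimes> g) \<otimes> h\<close>, apply \<open>mu_assoc\<close>, and move the associator
  past by naturality. Putting an arrow from \<open>\<I>\<close> in the first, last or middle place,
  with identities elsewhere, yields the three multiplier equations in turn.\<close>

lemma mu_assoc_arr:
  assumes "f \<in> Arr C" "g \<in> Arr C" "h \<in> Arr C" "Cod C f = S" "Cod C g = S" "Cod C h = S"
  shows "\<mu> \<cdot> ((\<mu> \<cdot> (f \<otimes> g)) \<otimes> h)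
    = \<mu> \<cdot> ((f \<otimes> (\<mu> \<cdot> (g \<otimes> h))) \<cdot> \<alpha> (Dom C f) (Dom C g) (Dom C h))"
proof -
  have "\<mu> \<cdot> ((\<mu> \<cdot> (f \<otimes> g)) \<otimes> h) = (\<mu> \<cdot> (\<mu> \<otimes> \<one> S)) \<cdot> ((f \<otimes> g) \<otimes> h)"
    using assms by (simp add: comp_assoc_arr interchange)
  also have "\<dots> = \<mu> \<cdot> ((\<one> S \<otimes> \<mu>) \<cdot> (\<alpha> S S S \<cdot> ((f \<otimes> g) \<otimes> h)))"
    using assms by (simp add: mu_assoc comp_assoc_arr)
  also have "\<dots> = \<mu> \<cdot> ((f \<otimes> (\<mu> \<cdot> (g \<otimes> h))) \<cdot> \<alpha> (Dom C f) (Dom C g) (Dom C h))"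
    using assms assoc_natural_arr[of f g h] by (simp add: interchange_assoc dom_in_Obj)
  finally show ?thesis .
qed

text \<open>Associativity with \<open>f\<close> in the first place, tested after
  \<open>\<lambda>\<^sub>u S \<otimes> \<one> S\<close>; \<open>lunitor_tensor\<close> and
  naturality of the unitor at \<open>\<mu>\<close> absorb the associator.\<close>

lemma left_mult_mu:
  assumes f: "f \<in> Hom C \<I> S"
  shows "L f \<cdot> \<mu> = \<mu> \<cdot> (L f \<otimes> \<one> S)"
proof (rule iso_cancel_right)
  note [simp] = f f[unfolded mem_Hom_iff]
  show "iso_arrow C (\<lambda>\<^sub>u S \<otimes> \<one> S)"
    by (simp add: iso_arrow_tensor iso_arrow_id)
  have "(L f \<cdot> \<mu>) \<cdot> (\<lambda>\<^sub>u S \<otimes> \<one> S) = L f \<cdot> ((\<mu> \<cdot> \<lambda>\<^sub>u (S \<otimes>\<^sub>o S)) \<cdot> \<alpha> \<I> S S)"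
    by (simp add: lunitor_tensor[symmetric] comp_assoc_arr)
  also have "\<dots> = L f \<cdot> ((\<lambda>\<^sub>u S \<cdot> (\<one> \<I> \<otimes> \<mu>)) \<cdot> \<alpha> \<I> S S)"
    using lunitor_natural_arr[of \<mu>] by simp
  also have "\<dots> = (L f \<cdot> \<lambda>\<^sub>u S) \<cdot> ((\<one> \<I> \<otimes> \<mu>) \<cdot> \<alpha> \<I> S S)"
    by (simp add: comp_assoc_arr)
  \<comment> \<open>The trivial factor \<open>\<one> S \<otimes> \<one> S\<close> puts
    \<open>\<mu>\<close> into the shape required by \<open>mu_assoc_arr\<close>.\<close>
  also have "\<dots> = \<mu> \<cdot> ((f \<otimes> (\<mu> \<cdot> (\<one> S \<otimes> \<one> S))) \<cdot> \<alpha> \<I> S S)"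
    by (simp add: left_mult_lunitor comp_assoc_arr interchange_assoc)
  also have "\<dots> = \<mu> \<cdot> ((L f \<cdot> \<lambda>\<^sub>u S) \<otimes> \<one> S)"
    using mu_assoc_arr[of f "\<one> S" "\<one> S"] by (simp add: left_mult_lunitor)
  also have "\<dots> = (\<mu> \<cdot> (L f \<otimes> \<one> S)) \<cdot> (\<lambda>\<^sub>u S \<otimes> \<one> S)"
    by (simp add: comp_assoc_arr interchange)
  finally show "(L f \<cdot> \<mu>) \<cdot> (\<lambda>\<^sub>u S \<otimes> \<one> S) = (\<mu> \<cdot> (L f \<otimes> \<one> S)) \<cdot> (\<lambda>\<^sub>u S \<otimes> \<one> S)" .
qed (use f in auto)

text \<open>Associativity with \<open>f\<close> in the last place, tested after
  \<open>\<rho>\<^sub>u (S \<otimes>\<^sub>o S)\<close>, which \<open>runitor_tensor\<close>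
  splits.\<close>

lemma right_mult_mu:
  assumes f: "f \<in> Hom C \<I> S"
  shows "R f \<cdot> \<mu> = \<mu> \<cdot> (\<one> S \<otimes> R f)"
proof (rule iso_cancel_right)
  note [simp] = f f[unfolded mem_Hom_iff]
  show "iso_arrow C (\<rho>\<^sub>u (S \<otimes>\<^sub>o S))"
    by simp
  have "(R f \<cdot> \<mu>) \<cdot> \<rho>\<^sub>u (S \<otimes>\<^sub>o S) = (R f \<cdot> \<rho>\<^sub>u S) \<cdot> (\<mu> \<otimes> \<one> \<I>)"
    using runitor_natural_arr[of \<mu>] by (simp add: comp_assoc_arr)
  also have "\<dots> = \<mu> \<cdot> ((\<mu> \<cdot> (\<one> S \<otimes> \<one> S)) \<otimes> f)"
    by (simp add: right_mult_runitor comp_assoc_arr interchange)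
  also have "\<dots> = \<mu> \<cdot> ((\<one> S \<otimes> (R f \<cdot> \<rho>\<^sub>u S)) \<cdot> \<alpha> S S \<I>)"
    using mu_assoc_arr[of "\<one> S" "\<one> S" f] by (simp add: right_mult_runitor)
  also have "\<dots> = (\<mu> \<cdot> (\<one> S \<otimes> R f)) \<cdot> \<rho>\<^sub>u (S \<otimes>\<^sub>o S)"
    by (simp add: runitor_tensor comp_assoc_arr interchange_assoc)
  finally show "(R f \<cdot> \<mu>) \<cdot> \<rho>\<^sub>u (S \<otimes>\<^sub>o S) = (\<mu> \<cdot> (\<one> S \<otimes> R f)) \<cdot> \<rho>\<^sub>u (S \<otimes>\<^sub>o S)" .
qed (use f in auto)

text \<open>Associativity with \<open>f\<close> in the middle place; the triangle accounts for the
  associator \<open>\<alpha> S \<I> S\<close>.\<close>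

lemma mu_left_mult_eq_mu_right_mult:
  assumes f: "f \<in> Hom C \<I> S"
  shows "\<mu> \<cdot> (\<one> S \<otimes> L f) = \<mu> \<cdot> (R f \<otimes> \<one> S)"
proof (rule iso_cancel_right)
  note [simp] = f f[unfolded mem_Hom_iff]
  show "iso_arrow C (\<rho>\<^sub>u S \<otimes> \<one> S)"
    by (simp add: iso_arrow_tensor iso_arrow_id)
  have "(\<mu> \<cdot> (\<one> S \<otimes> L f)) \<cdot> (\<rho>\<^sub>u S \<otimes> \<one> S) = \<mu> \<cdot> ((\<one> S \<otimes> (L f \<cdot> \<lambda>\<^sub>u S)) \<cdot> \<alpha> S \<I> S)"
    by (simp add: triangle[symmetric] comp_assoc_arr interchange_assoc)
  also have "\<dots> = \<mu> \<cdot> ((R f \<cdot> \<rho>\<^sub>u S) \<otimes> \<one> S)"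
    using mu_assoc_arr[of "\<one> S" f "\<one> S"] by (simp add: left_mult_lunitor right_mult_runitor)
  also have "\<dots> = (\<mu> \<cdot> (R f \<otimes> \<one> S)) \<cdot> (\<rho>\<^sub>u S \<otimes> \<one> S)"
    by (simp add: comp_assoc_arr interchange)
  finally show "(\<mu> \<cdot> (\<one> S \<otimes> L f)) \<cdot> (\<rho>\<^sub>u S \<otimes> \<one> S) = (\<mu> \<cdot> (R f \<otimes> \<one> S)) \<cdot> (\<rho>\<^sub>u S \<otimes> \<one> S)" .
qed (use f in auto)

lemma mult_map_in_Mult: "f \<in> Hom C \<I> S \<Longrightarrow> mult_map C S \<mu> f \<in> Mult C S \<mu>"
  by (auto simp: mult_map_def Mult_def mem_Hom_iff[of "L f"] mem_Hom_iff[of "R f"]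
      left_mult_mu right_mult_mu mu_left_mult_eq_mu_right_mult)

section \<open>Convolution and its compatibility with the multiplications\<close>

lemma conv_in_Hom: "\<lbrakk>g \<in> Hom C \<I> S; f \<in> Hom C \<I> S\<rbrakk> \<Longrightarrow> conv C \<mu> g f \<in> Hom C \<I> S"
  by (simp add: conv_def mem_Hom_iff)

lemma conv_lunitor:
  "\<lbrakk>g \<in> Hom C \<I> S; f \<in> Hom C \<I> S\<rbrakk> \<Longrightarrow> conv C \<mu> g f \<cdot> \<lambda>\<^sub>u \<I> = \<mu> \<cdot> (g \<otimes> f)"
  by (simp add: conv_def mem_Hom_iff comp_assoc_arr)

text \<open>Naturality of the left unitor at \<open>f\<close> reduces this to \<open>(g \<otimes>
  \<one> S) \<cdot> (\<one> \<I> \<otimes> f) = g \<otimes> f\<close>.\<close>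

lemma conv_eq_left_mult:
  assumes g: "g \<in> Hom C \<I> S" and f: "f \<in> Hom C \<I> S"
  shows "conv C \<mu> g f = L g \<cdot> f"
proof (rule iso_cancel_right)
  note [simp] = g f g[unfolded mem_Hom_iff] f[unfolded mem_Hom_iff]
  have "(L g \<cdot> f) \<cdot> \<lambda>\<^sub>u \<I> = (L g \<cdot> \<lambda>\<^sub>u S) \<cdot> (\<one> \<I> \<otimes> f)"
    using lunitor_natural_arr[of f] by (simp add: comp_assoc_arr)
  also have "\<dots> = conv C \<mu> g f \<cdot> \<lambda>\<^sub>u \<I>"
    by (simp add: left_mult_lunitor conv_lunitor comp_assoc_arr interchange)
  finally show "conv C \<mu> g f \<cdot> \<lambda>\<^sub>u \<I> = (L g \<cdot> f) \<cdot> \<lambda>\<^sub>u \<I>" ..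
qed (use g f conv_in_Hom[OF g f] in \<open>auto simp: mem_Hom_iff[of f] mem_Hom_iff[of "conv C \<mu> g f"]\<close>)

text \<open>Convolution is defined with \<open>\<lambda>\<^sub>u \<I>\<close>, whereas naturality of
  the right unitor at \<open>g\<close> produces \<open>\<rho>\<^sub>u \<I>\<close>; the argument
  rests on the equality of the two.\<close>

lemma conv_eq_right_mult:
  assumes g: "g \<in> Hom C \<I> S" and f: "f \<in> Hom C \<I> S"
  shows "conv C \<mu> g f = R f \<cdot> g"
proof (rule iso_cancel_right)
  note [simp] = g f g[unfolded mem_Hom_iff] f[unfolded mem_Hom_iff]
  have "(R f \<cdot> g) \<cdot> \<lambda>\<^sub>u \<I> = (R f \<cdot> \<rho>\<^sub>u S) \<cdot> (g \<otimes> \<one> \<I>)"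
    using runitor_natural_arr[of g] by (simp add: lunitor_unit_eq_runitor_unit comp_assoc_arr)
  also have "\<dots> = conv C \<mu> g f \<cdot> \<lambda>\<^sub>u \<I>"
    by (simp add: right_mult_runitor conv_lunitor comp_assoc_arr interchange)
  finally show "conv C \<mu> g f \<cdot> \<lambda>\<^sub>u \<I> = (R f \<cdot> g) \<cdot> \<lambda>\<^sub>u \<I>" ..
qed (use g f conv_in_Hom[OF g f] in \<open>auto simp: mem_Hom_iff[of g] mem_Hom_iff[of "conv C \<mu> g f"]\<close>)

text \<open>The multiplier equation for \<open>L g\<close> carries it through \<open>\<mu>\<close>
  onto \<open>f\<close>, where \<open>L g \<cdot> f\<close> is the convolution.\<close>

lemma left_mult_conv:
  assumes g: "g \<in> Hom C \<I> S" and f: "f \<in> Hom C \<I> S"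
  shows "L (conv C \<mu> g f) = L g \<cdot> L f"
proof (rule left_mult_eqI)
  note [simp] = g f g[unfolded mem_Hom_iff] f[unfolded mem_Hom_iff]
  have "(L g \<cdot> L f) \<cdot> \<lambda>\<^sub>u S = (L g \<cdot> \<mu>) \<cdot> (f \<otimes> \<one> S)"
    by (simp add: left_mult_lunitor comp_assoc_arr)
  also have "\<dots> = \<mu> \<cdot> (conv C \<mu> g f \<otimes> \<one> S)"
    by (simp add: left_mult_mu conv_eq_left_mult comp_assoc_arr interchange)
  finally show "(L g \<cdot> L f) \<cdot> \<lambda>\<^sub>u S = \<mu> \<cdot> (conv C \<mu> g f \<otimes> \<one> S)" .
qed (use g f in \<open>auto simp: conv_in_Hom mem_Hom_iff[of "_ \<cdot> _"]\<close>)

text \<open>Here \<open>R f\<close> is carried through \<open>\<mu>\<close> onto \<open>g\<close>.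
  The resulting reversal of order is the one built into the second component of
  \<open>mult_star\<close>.\<close>

lemma right_mult_conv:
  assumes g: "g \<in> Hom C \<I> S" and f: "f \<in> Hom C \<I> S"
  shows "R (conv C \<mu> g f) = R f \<cdot> R g"
proof (rule right_mult_eqI)
  note [simp] = g f g[unfolded mem_Hom_iff] f[unfolded mem_Hom_iff]
  have "(R f \<cdot> R g) \<cdot> \<rho>\<^sub>u S = (R f \<cdot> \<mu>) \<cdot> (\<one> S \<otimes> g)"
    by (simp add: right_mult_runitor comp_assoc_arr)
  also have "\<dots> = \<mu> \<cdot> (\<one> S \<otimes> conv C \<mu> g f)"
    by (simp add: right_mult_mu conv_eq_right_mult comp_assoc_arr interchange)
  finally show "(R f \<cdot> R g) \<cdot> \<rho>\<^sub>u S = \<mu> \<cdot> (\<one> S \<otimes> conv C \<mu> g f)" .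
qed (use g f in \<open>auto simp: conv_in_Hom mem_Hom_iff[of "_ \<cdot> _"]\<close>)

lemma mult_map_conv:
  "\<lbrakk>g \<in> Hom C \<I> S; f \<in> Hom C \<I> S\<rbrakk>
    \<Longrightarrow> mult_map C S \<mu> (conv C \<mu> g f) = mult_star C (mult_map C S \<mu> g) (mult_map C S \<mu> f)"
  by (simp add: mult_map_def mult_star_def left_mult_conv right_mult_conv)

text \<open>With convolution written as the action of \<open>L\<close>, its associativity is
  \<open>left_mult_conv\<close> applied to \<open>f\<close>.\<close>

lemma conv_semigroup: "semigroup_on (Hom C \<I> S) (conv C \<mu>)"
proof
  fix h g f
  assume *: "h \<in> Hom C \<I> S" "g \<in> Hom C \<I> S" "f \<in> Hom C \<I> S"
  have "conv C \<mu> (conv C \<mu> h g) f = (L h \<cdot> L g) \<cdot> f"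
    using * by (simp add: conv_eq_left_mult[of "conv C \<mu> h g"] conv_in_Hom left_mult_conv)
  also have "\<dots> = L h \<cdot> conv C \<mu> g f"
    using * by (simp add: conv_eq_left_mult comp_assoc_arr mem_Hom_iff[of f])
  also have "\<dots> = conv C \<mu> h (conv C \<mu> g f)"
    using * by (simp add: conv_eq_left_mult[of h] conv_in_Hom)
  finally show "conv C \<mu> (conv C \<mu> h g) f = conv C \<mu> h (conv C \<mu> g f)" .
qed (rule conv_in_Hom)

section \<open>The semigroup of multipliers and the homomorphism into it\<close>

lemma mult_star_in_Mult:
  assumes "p \<in> Mult C S \<mu>" "q \<in> Mult C S \<mu>"
  shows "mult_star C p q \<in> Mult C S \<mu>"
proof -
  obtain l' r' l r where pq: "p = (l', r')" "q = (l, r)"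
    by (cases p, cases q)
  have [simp]: "l' \<in> Arr C" "Dom C l' = S" "Cod C l' = S" "r' \<in> Arr C" "Dom C r' = S" "Cod C r' = S"
      "l \<in> Arr C" "Dom C l = S" "Cod C l = S" "r \<in> Arr C" "Dom C r = S" "Cod C r = S"
    and mults: "l' \<cdot> \<mu> = \<mu> \<cdot> (l' \<otimes> \<one> S)" "r' \<cdot> \<mu> = \<mu> \<cdot> (\<one> S \<otimes> r')"
      "\<mu> \<cdot> (\<one> S \<otimes> l') = \<mu> \<cdot> (r' \<otimes> \<one> S)"
      "l \<cdot> \<mu> = \<mu> \<cdot> (l \<otimes> \<one> S)" "r \<cdot> \<mu> = \<mu> \<cdot> (\<one> S \<otimes> r)"
      "\<mu> \<cdot> (\<one> S \<otimes> l) = \<mu> \<cdot> (r \<otimes> \<one> S)"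
    using assms by (auto simp: pq Mult_def mem_Hom_iff)
  have "(l' \<cdot> l) \<cdot> \<mu> = (l' \<cdot> \<mu>) \<cdot> (l \<otimes> \<one> S)"
    by (simp add: comp_assoc_arr mults(4))
  also have "\<dots> = \<mu> \<cdot> ((l' \<cdot> l) \<otimes> \<one> S)"
    by (simp add: mults(1) comp_assoc_arr interchange)
  finally have left: "(l' \<cdot> l) \<cdot> \<mu> = \<mu> \<cdot> ((l' \<cdot> l) \<otimes> \<one> S)" .
  have "(r \<cdot> r') \<cdot> \<mu> = (r \<cdot> \<mu>) \<cdot> (\<one> S \<otimes> r')"
    by (simp add: comp_assoc_arr mults(2))
  also have "\<dots> = \<mu> \<cdot> (\<one> S \<otimes> (r \<cdot> r'))"
    by (simp add: mults(5) comp_assoc_arr interchange)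
  finally have right: "(r \<cdot> r') \<cdot> \<mu> = \<mu> \<cdot> (\<one> S \<otimes> (r \<cdot> r'))" .
  have "\<mu> \<cdot> (\<one> S \<otimes> (l' \<cdot> l)) = (\<mu> \<cdot> (\<one> S \<otimes> l')) \<cdot> (\<one> S \<otimes> l)"
    by (simp add: comp_assoc_arr interchange)
  \<comment> \<open>The linking equation trades \<open>l'\<close> for \<open>r'\<close> in the other
    slot, where it commutes with \<open>\<one> S \<otimes> l\<close>. Only then is \<open>l\<close>
    traded for \<open>r\<close>, which leaves \<open>r\<close> after \<open>r'\<close>.\<close>
  also have "\<dots> = (\<mu> \<cdot> (\<one> S \<otimes> l)) \<cdot> (r' \<otimes> \<one> S)"
    by (simp add: mults(3) comp_assoc_arr interchange)
  also have "\<dots> = \<mu> \<cdot> ((r \<cdot> r') \<otimes> \<one> S)"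
    by (simp add: mults(6) comp_assoc_arr interchange)
  finally have "\<mu> \<cdot> (\<one> S \<otimes> (l' \<cdot> l)) = \<mu> \<cdot> ((r \<cdot> r') \<otimes> \<one> S)" .
  with left right show ?thesis
    by (simp add: pq mult_star_def Mult_def mem_Hom_iff)
qed

lemma Mult_semigroup: "semigroup_on (Mult C S \<mu>) (mult_star C)"
proof
  show "mult_star C (mult_star C p q) s = mult_star C p (mult_star C q s)"
    if "p \<in> Mult C S \<mu>" "q \<in> Mult C S \<mu>" "s \<in> Mult C S \<mu>" for p q s
    using that by (auto simp: mult_star_def Mult_def mem_Hom_iff comp_assoc_arr)
qed (rule mult_star_in_Mult)

lemma mult_map_homomorphism:
  "semigroup_homomorphism (Hom C \<I> S) (conv C \<mu>) (Mult C S \<mu>) (mult_star C) (mult_map C S \<mu>)"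
  by (intro semigroup_homomorphism.intro semigroup_homomorphism_axioms.intro)
    (auto simp: conv_semigroup Mult_semigroup mult_map_in_Mult mult_map_conv)

end

section \<open>Images of homomorphisms and the inner multipliers\<close>

lemma (in semigroup_homomorphism) image_subsemigroup: "subsemigroup (h ` M) N mul'"
proof
  show "h ` M \<subseteq> N"
    using hom_closed by auto
  show "mul' x y \<in> h ` M" if "x \<in> h ` M" "y \<in> h ` M" for x y
    using that by (auto simp: source.mul_closed simp flip: hom_mul)
qed

theorem proposition15:
  fixes C :: "('o, 'm) monoidal_category" and S :: 'o and \<mu> :: 'm
  assumes "monoidal_category C"
    and "semigroup_object C S \<mu>"
  shows "semigroup_homomorphism (Hom C \<I>\<^bsub>C\<^esub> S) (conv C \<mu>)
           (Mult C S \<mu>) (mult_star C) (mult_map C S \<mu>)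
         \<and> subsemigroup (InnMult C S \<mu>) (Mult C S \<mu>) (mult_star C)"
proof -
  interpret semigroup_object C S \<mu>
    by (fact assms(2))
  show ?thesis
    using mult_map_homomorphism semigroup_homomorphism.image_subsemigroup[OF mult_map_homomorphism]
    unfolding InnMult_def by blast
qed

end
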